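(* Let $H$ be a connected $r$-regular $u$-uniform hypergraph of girth at least $3$, of diameter $d$, with $n$ vertices. Let $k=r(u-1)$ and $q=(r-1)(u-1)$. Then each non-trivial eigenvalue $\lambda$ of $H$ (i.e. each eigenvalue $\lambda\ne k$) satisfies $$\left|G_d^{(r,u)}(\lambda)\right|\le 1+\sum_{i=0}^{d-1}kq^i-n.$$
   Context: A hypergraph $H=(V,E)$ consists of a finite vertex set $V$ and a set $E$ of subsets of $V$ (edges), each of size at least 2 (no repeated edges). It is $u$-uniform ($u\ge2$) if every edge has exactly $u$ vertices and $r$-regular ($r\ge 1$) if every vertex is in exactly $r$ edges. A walk of length $p$ from $x_0$ to $x_p$ is a sequence $(x_0,e_1,x_1,\ldots,e_p,x_p)$ of vertices and edges with $x_{i-1},x_i\in e_i$, $x_{i-1}\ne x_i$; $H$ is connected if any two vertices are joined by a walk, the distance between two vertices is the minimum length of a walk between them, and the diameter is the maximum distance. The girth is the minimum length of a Berge cycle (a walk with $x_0=x_p$ with all edges distinct and all vertices distinct except $x_0=x_p$), taken to be $\infty$ if there is none; girth at least 3 implies any two distinct vertices lie in at most one common edge. The adjacency matrix has entries $A_{xy}=|\{e\in E:\{x,y\}\subset e\}|$ for $x\neq y$ and $A_{xx}=0$; the eigenvalues of $H$ are those of $A$; the largest (trivial) one is $k$. The convention $0^0=1$ is used. Polynomials: $F_0^{(r,u)}=1$, $F_1^{(r,u)}=x$, $F_2^{(r,u)}=x^2-(u-2)x-r(u-1)$, $F_{i+1}^{(r,u)}(x)=(x-u+2)F_i^{(r,u)}(x)-(r-1)(u-1)F_{i-1}^{(r,u)}(x)$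 for $i\ge 2$; $G_i^{(r,u)}(x)=\sum_{j=0}^i F_j^{(r,u)}(x)$. *)

theory Defs
  imports
    Jordan_Normal_Form.Char_Poly
    "HOL-Library.Extended_Nat"
begin

definition hypergraph :: "'a set \<Rightarrow> 'a set set \<Rightarrow> bool" where
  "hypergraph V E \<longleftrightarrow> finite V \<and> (\<forall>e\<in>E. e \<subseteq> V \<and> 2 \<le> card e)"

definition hg_uniform :: "nat \<Rightarrow> 'a set set \<Rightarrow> bool" where
  "hg_uniform u E \<longleftrightarrow> 2 \<le> u \<and> (\<forall>e\<in>E. card e = u)"

definition hg_regular :: "nat \<Rightarrow> 'a set \<Rightarrow> 'a set set \<Rightarrow> bool" where
  "hg_regular r V E \<longleftrightarrow> 1 \<le> r \<and> (\<forall>x\<in>V. card {e \<in> E. x \<in> e} = r)"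

text \<open>
  The walk \<open>(x\<^sub>0, e\<^sub>1, x\<^sub>1, \<dots>, e\<^sub>p, x\<^sub>p)\<close> is given by its list of vertices
  \<open>xs = [x\<^sub>0, \<dots>, x\<^sub>p]\<close> and its list of edges \<open>es = [e\<^sub>1, \<dots>, e\<^sub>p]\<close>, so that
  the edge \<open>es ! i\<close> joins \<open>xs ! i\<close> to \<open>xs ! Suc i\<close>.
\<close>

definition hg_walk :: "'a set \<Rightarrow> 'a set set \<Rightarrow> 'a list \<Rightarrow> 'a set list \<Rightarrow> bool" where
  "hg_walk V E xs es \<longleftrightarrow>
     length xs = Suc (length es) \<and> set xs \<subseteq> V \<and> set es \<subseteq> E \<and>
     (\<forall>i < length es. xs ! i \<in> es ! i \<and> xs ! Suc i \<in> es ! i \<and> xs ! i \<noteq> xs ! Suc i)"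

definition hg_joined :: "'a set \<Rightarrow> 'a set set \<Rightarrow> nat \<Rightarrow> 'a \<Rightarrow> 'a \<Rightarrow> bool" where
  "hg_joined V E p x y \<longleftrightarrow>
     (\<exists>xs es. hg_walk V E xs es \<and> length es = p \<and> hd xs = x \<and> last xs = y)"

definition hg_connected :: "'a set \<Rightarrow> 'a set set \<Rightarrow> bool" where
  "hg_connected V E \<longleftrightarrow> (\<forall>x\<in>V. \<forall>y\<in>V. \<exists>p. hg_joined V E p x y)"

text \<open>Only meaningful for vertices that are joined by some walk.\<close>

definition hg_dist :: "'a set \<Rightarrow> 'a set set \<Rightarrow> 'a \<Rightarrow> 'a \<Rightarrow> nat" where
  "hg_dist V E x y = (LEAST p. hg_joined V E p x y)"

text \<open>Only meaningful for connected hypergraphs with at least one vertex.\<close>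

definition hg_diameter :: "'a set \<Rightarrow> 'a set set \<Rightarrow> nat" where
  "hg_diameter V E = Max {hg_dist V E x y | x y. x \<in> V \<and> y \<in> V}"

text \<open>
  The one-vertex walk without edges is not a cycle. Since consecutive vertices of a walk
  are different, \<open>es \<noteq> []\<close> already forces a Berge cycle to have length at least 2.
\<close>

definition berge_cycle :: "'a set \<Rightarrow> 'a set set \<Rightarrow> 'a list \<Rightarrow> 'a set list \<Rightarrow> bool" where
  "berge_cycle V E xs es \<longleftrightarrow>
     hg_walk V E xs es \<and> es \<noteq> [] \<and> hd xs = last xs \<and> distinct es \<and> distinct (butlast xs)"

text \<open>The infimum of the empty set in \<^typ>\<open>enat\<close> is \<open>\<infinity>\<close>.\<close>

definition hg_girth :: "'a set \<Rightarrow> 'a set set \<Rightarrow> enat" where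
  "hg_girth V E = Inf {enat (length es) | xs es. berge_cycle V E xs es}"

definition hg_adj :: "'a set set \<Rightarrow> 'a \<Rightarrow> 'a \<Rightarrow> nat" where
  "hg_adj E x y = (if x = y then 0 else card {e \<in> E. {x, y} \<subseteq> e})"

text \<open>
  The rows and columns of a \<^typ>\<open>real mat\<close> are indexed by numbers, so the adjacency matrix
  depends on an enumeration \<open>vs\<close> of the vertices. Different enumerations give matrices
  that are conjugate by a permutation matrix, hence have the same eigenvalues.
\<close>

definition hg_adj_mat :: "'a set set \<Rightarrow> 'a list \<Rightarrow> real mat" where
  "hg_adj_mat E vs =
     mat (length vs) (length vs) (\<lambda>(i, j). real (hg_adj E (vs ! i) (vs ! j)))"

definition hg_eigenvalue :: "'a set \<Rightarrow> 'a set set \<Rightarrow> real \<Rightarrow> bool" where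
  "hg_eigenvalue V E lam \<longleftrightarrow>
     (\<exists>vs. distinct vs \<and> set vs = V \<and> eigenvalue (hg_adj_mat E vs) lam)"

text \<open>
  The coefficients are computed in \<^typ>\<open>real\<close>, so no truncated subtraction occurs.
  Polynomials are listed with the constant coefficient first.
\<close>

fun F_poly :: "nat \<Rightarrow> nat \<Rightarrow> nat \<Rightarrow> real poly" where
  "F_poly r u 0 = 1"
| "F_poly r u (Suc 0) = [:0, 1:]"
| "F_poly r u (Suc (Suc 0)) = [:- (real r * (real u - 1)), - (real u - 2), 1:]"
| "F_poly r u (Suc (Suc (Suc i))) =
     [:- (real u - 2), 1:] * F_poly r u (Suc (Suc i))
       - Polynomial.smult ((real r - 1) * (real u - 1)) (F_poly r u (Suc i))"

definition G_poly :: "nat \<Rightarrow> nat \<Rightarrow> nat \<Rightarrow> real poly" where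
  "G_poly r u i = (\<Sum>j\<le>i. F_poly r u j)"

end

theory Submission
  imports Defs "HOL-Library.Indicator_Function"
begin

text \<open>
  Let \<open>N\<^sub>i\<close> be the operator on functions on the vertices that sums a function over the end points
  of all walks of length \<open>i\<close> without two equal consecutive edges. Then \<open>N\<^sub>i = F\<^sub>i(A)\<close>, so
  \<open>K = N\<^sub>0 + \<dots> + N\<^sub>d\<close> equals \<open>G\<^sub>d(A)\<close>. Shortest walks do not repeat an edge consecutively, hence
  all entries of \<open>K\<close> are at least 1. So \<open>K - J\<close>, with \<open>J\<close> the all-ones matrix, is nonnegative with
  row sums \<open>G\<^sub>d(k) - n\<close>. An eigenvector for \<open>\<lambda> \<noteq> k\<close> is orthogonal to the constants, hence is an
  eigenvector of \<open>K - J\<close> for \<open>G\<^sub>d(\<lambda>)\<close>, and this is bounded by the row sum.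
\<close>

section \<open>Walks, distances and the diameter\<close>

lemma hg_joined_0_iff: "hg_joined V E 0 x y \<longleftrightarrow> x \<in> V \<and> x = y"
proof
  assume "x \<in> V \<and> x = y"
  then have "hg_walk V E [x] [] \<and> length ([] :: 'a set list) = 0 \<and> hd [x] = x \<and> last [x] = y"
    by (auto simp: hg_walk_def)
  then show "hg_joined V E 0 x y"
    unfolding hg_joined_def by blast
qed (auto simp: hg_joined_def hg_walk_def length_Suc_conv)

lemma hg_walk_Cons:
  "hg_walk V E (x # xs) (e # es) \<longleftrightarrow>
     x \<in> V \<and> e \<in> E \<and> x \<in> e \<and> hd xs \<in> e \<and> x \<noteq> hd xs \<and> hg_walk V E xs es"
proof (cases xs)
  case (Cons y ys)
  then show ?thesis
    by (auto simp: hg_walk_def less_Suc_eq_0_disj)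
qed (simp add: hg_walk_def)

lemma hg_joined_Suc_iff:
  "hg_joined V E (Suc p) x z \<longleftrightarrow>
     (\<exists>e\<in>E. \<exists>y. x \<in> V \<and> x \<in> e \<and> y \<in> e \<and> x \<noteq> y \<and> hg_joined V E p y z)"
proof
  assume "hg_joined V E (Suc p) x z"
  then obtain xs es where w: "hg_walk V E xs es" "length es = Suc p" "hd xs = x" "last xs = z"
    by (auto simp: hg_joined_def)
  then obtain e es' where es: "es = e # es'" "length es' = p"
    by (auto simp: length_Suc_conv)
  have "length xs = Suc (Suc p)"
    using w by (simp add: hg_walk_def)
  then obtain xs' where xs: "xs = x # xs'" "xs' \<noteq> []"
    using w(3) by (metis Zero_not_Suc length_0_conv length_Suc_conv list.sel(1))
  have "hg_joined V E p (hd xs') z"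
    using w es xs by (auto simp: hg_joined_def hg_walk_Cons)
  then show "\<exists>e\<in>E. \<exists>y. x \<in> V \<and> x \<in> e \<and> y \<in> e \<and> x \<noteq> y \<and> hg_joined V E p y z"
    using w(1) unfolding es xs hg_walk_Cons by blast
next
  assume "\<exists>e\<in>E. \<exists>y. x \<in> V \<and> x \<in> e \<and> y \<in> e \<and> x \<noteq> y \<and> hg_joined V E p y z"
  then obtain e xs es where w: "e \<in> E" "x \<in> V" "x \<in> e" "hd xs \<in> e" "x \<noteq> hd xs"
    "hg_walk V E xs es" "length es = p" "last xs = z"
    by (auto simp: hg_joined_def)
  have "hg_walk V E (x # xs) (e # es)"
    using w by (simp add: hg_walk_Cons)
  moreover have "last (x # xs) = z"
    using w by (auto simp: hg_walk_def)
  ultimately show "hg_joined V E (Suc p) x z"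
    unfolding hg_joined_def using w(7) by (metis length_Cons list.sel(1))
qed

lemma hg_joined_dist:
  assumes "hg_connected V E" "x \<in> V" "y \<in> V"
  shows "hg_joined V E (hg_dist V E x y) x y"
  using assms unfolding hg_dist_def hg_connected_def by (metis LeastI)

lemma not_hg_joined_less_dist: "m < hg_dist V E x y \<Longrightarrow> \<not> hg_joined V E m x y"
  unfolding hg_dist_def by (rule not_less_Least)

lemma hg_dist_le_diameter:
  assumes "finite V" "x \<in> V" "y \<in> V"
  shows "hg_dist V E x y \<le> hg_diameter V E"
proof -
  have "{hg_dist V E x y | x y. x \<in> V \<and> y \<in> V} = (\<lambda>(x, y). hg_dist V E x y) ` (V \<times> V)"
    by auto
  then have "finite {hg_dist V E x y | x y. x \<in> V \<and> y \<in> V}"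
    using assms(1) by simp
  then show ?thesis
    unfolding hg_diameter_def using assms by (intro Max_ge) auto
qed

text \<open>Reindexing an eigenvector along the enumeration turns it into a function on the
  vertices, so that the rest of the argument never refers to an ordering of
  \<open>V\<close>.\<close>

lemma hg_eigenfunction:
  assumes "hg_eigenvalue V E lam"
  obtains f where "\<exists>x\<in>V. f x \<noteq> 0"
    and "\<And>x. x \<in> V \<Longrightarrow> (\<Sum>y\<in>V. real (hg_adj E x y) * f y) = lam * f x"
proof -
  obtain vs where vs: "distinct vs" "set vs = V" and "eigenvalue (hg_adj_mat E vs) lam"
    using assms by (auto simp: hg_eigenvalue_def)
  then obtain v where v: "v \<in> carrier_vec (length vs)" "v \<noteq> 0\<^sub>v (length vs)"
    "hg_adj_mat E vs *\<^sub>v v = lam \<cdot>\<^sub>v v"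
    by (auto simp: eigenvalue_def eigenvector_def hg_adj_mat_def)
  have bij: "bij_betw ((!) vs) {..<length vs} V"
    using vs by (intro bij_betw_nth) auto
  define f where "f x = v $ inv_into {..<length vs} ((!) vs) x" for x
  have f: "f (vs ! i) = v $ i" if "i < length vs" for i
    using bij that by (auto simp: f_def bij_betw_def)
  show ?thesis
  proof
    obtain i where "i < length vs" "v $ i \<noteq> 0"
      using v(1,2) by (metis carrier_vecD eq_vecI index_zero_vec)
    then show "\<exists>x\<in>V. f x \<noteq> 0"
      using f vs(2) by (metis nth_mem)
  next
    fix x assume "x \<in> V"
    then obtain i where i: "i < length vs" "x = vs ! i"
      using vs(2) by (metis in_set_conv_nth)
    have "lam * f x = (hg_adj_mat E vs *\<^sub>v v) $ i"
      using i f v(1) by (simp add: v(3))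
    also have "\<dots> = (\<Sum>j<length vs. real (hg_adj E x (vs ! j)) * f (vs ! j))"
      using i v(1) f by (simp add: hg_adj_mat_def scalar_prod_def atLeast0LessThan)
    also have "\<dots> = (\<Sum>y\<in>V. real (hg_adj E x y) * f y)"
      by (rule sum.reindex_bij_betw[OF bij])
    finally show "(\<Sum>y\<in>V. real (hg_adj E x y) * f y) = lam * f x" ..
  qed
qed

section \<open>Sums over walks without repeated consecutive edges\<close>

text \<open>
  Sums \<open>f\<close> over the end points of the walks of length \<open>i\<close> from \<open>x\<close> in which consecutive edges
  differ and the first edge is not \<open>e\<close>. For \<open>e = {}\<close> the condition on the first edge is void.
\<close>

primrec nb_sum :: "'a set set \<Rightarrow> ('a \<Rightarrow> real) \<Rightarrow> nat \<Rightarrow> 'a set \<Rightarrow> 'a \<Rightarrow> real" where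
  "nb_sum E f 0 e x = f x"
| "nb_sum E f (Suc i) e x =
     (\<Sum>e'\<in>{e' \<in> E. x \<in> e'} - {e}. \<Sum>y\<in>e' - {x}. nb_sum E f i e' y)"

lemma nb_sum_nonneg: "(\<And>x. f x \<ge> 0) \<Longrightarrow> nb_sum E f i e x \<ge> 0"
  by (induction i arbitrary: e x) (auto intro!: sum_nonneg)

section \<open>The adjacency operator of a regular uniform hypergraph\<close>

locale regular_uniform_hypergraph =
  fixes V :: "'a set" and E :: "'a set set" and r u :: nat
  assumes finite_V: "finite V"
    and edge_subset: "e \<in> E \<Longrightarrow> e \<subseteq> V"
    and card_edge: "e \<in> E \<Longrightarrow> card e = u"
    and degree: "x \<in> V \<Longrightarrow> card {e \<in> E. x \<in> e} = r"
    and two_le_u: "2 \<le> u"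
    and one_le_r: "1 \<le> r"
begin

lemma finite_E: "finite E"
  using finite_V edge_subset by (meson PowI finite_Pow_iff finite_subset subsetI)

lemma finite_edge: "e \<in> E \<Longrightarrow> finite e"
  using edge_subset finite_V finite_subset by blast

text \<open>The entry at \<open>x\<close>, \<open>y\<close> counts the edges through both, so
  exchanging the two sums turns the adjacency operator into the sum over all single steps out of
  \<open>x\<close>.\<close>

lemma sum_adj_eq:
  assumes "x \<in> V"
  shows "(\<Sum>y\<in>V. real (hg_adj E x y) * f y) = (\<Sum>e | e \<in> E \<and> x \<in> e. \<Sum>y\<in>e - {x}. f y)"
proof -
  have "real (hg_adj E x y) = (\<Sum>e | e \<in> E \<and> x \<in> e. if y \<in> e - {x} then 1 else 0)" for y
  proof (cases "x = y")
    case False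
    then have "{e \<in> E. {x, y} \<subseteq> e} = {e \<in> E. x \<in> e} \<inter> {e. y \<in> e - {x}}"
      by auto
    then show ?thesis
      using False finite_E by (simp add: hg_adj_def sum.If_cases)
  qed (simp add: hg_adj_def)
  then have "(\<Sum>y\<in>V. real (hg_adj E x y) * f y)
      = (\<Sum>y\<in>V. \<Sum>e | e \<in> E \<and> x \<in> e. if y \<in> e - {x} then f y else 0)"
    by (simp add: sum_distrib_right if_distrib[of "\<lambda>a. a * _"] cong: if_cong)
  also have "\<dots> = (\<Sum>e | e \<in> E \<and> x \<in> e. \<Sum>y\<in>V. if y \<in> e - {x} then f y else 0)"
    by (rule sum.swap)
  also have "\<dots> = (\<Sum>e | e \<in> E \<and> x \<in> e. \<Sum>y\<in>e - {x}. f y)"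
  proof (rule sum.cong[OF refl])
    fix e assume "e \<in> {e \<in> E. x \<in> e}"
    then have "V \<inter> (e - {x}) = e - {x}"
      using edge_subset by blast
    then show "(\<Sum>y\<in>V. if y \<in> e - {x} then f y else 0) = (\<Sum>y\<in>e - {x}. f y)"
      using finite_V by (metis sum.inter_restrict)
  qed
  finally show ?thesis .
qed

lemma sum_adj_row:
  assumes "x \<in> V"
  shows "(\<Sum>y\<in>V. real (hg_adj E x y)) = real r * (real u - 1)"
proof -
  have "(\<Sum>y\<in>V. real (hg_adj E x y)) = (\<Sum>e | e \<in> E \<and> x \<in> e. \<Sum>y\<in>e - {x}. 1)"
    using sum_adj_eq[OF assms, of "\<lambda>_. 1"] by simp
  also have "\<dots> = (\<Sum>e | e \<in> E \<and> x \<in> e. real u - 1)"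
    using two_le_u card_edge finite_edge by (intro sum.cong) (auto simp: of_nat_diff)
  also have "\<dots> = real r * (real u - 1)"
    using degree[OF assms] by simp
  finally show ?thesis .
qed

text \<open>The matrix is symmetric with constant row sums. Summing the eigenvalue equation over
  \<open>V\<close> therefore multiplies the total of \<open>f\<close> by \<open>lam\<close> on one
  side and by the row sum on the other.\<close>

lemma eigenfunction_sum_zero:
  assumes "\<And>x. x \<in> V \<Longrightarrow> (\<Sum>y\<in>V. real (hg_adj E x y) * f y) = lam * f x"
    and "lam \<noteq> real r * (real u - 1)"
  shows "(\<Sum>x\<in>V. f x) = 0"
proof -
  have "lam * (\<Sum>x\<in>V. f x) = (\<Sum>x\<in>V. \<Sum>y\<in>V. real (hg_adj E x y) * f y)"
    by (simp add: sum_distrib_left assms(1))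
  also have "\<dots> = (\<Sum>y\<in>V. \<Sum>x\<in>V. real (hg_adj E x y) * f y)"
    by (rule sum.swap)
  also have "\<dots> = (\<Sum>y\<in>V. (\<Sum>x\<in>V. real (hg_adj E y x)) * f y)"
    by (simp add: sum_distrib_right hg_adj_def insert_commute eq_commute cong: if_cong)
  also have "\<dots> = real r * (real u - 1) * (\<Sum>y\<in>V. f y)"
    by (simp add: sum_adj_row sum_distrib_left)
  finally show ?thesis
    using assms(2) by simp
qed

section \<open>The recurrence matching that of \<open>F_poly\<close>\<close>

lemma nb_sum_Suc_avoid:
  assumes "e \<in> E" "x \<in> e"
  shows "nb_sum E f (Suc i) e x = nb_sum E f (Suc i) {} x - (\<Sum>y\<in>e - {x}. nb_sum E f i e y)"
proof -
  have "{e' \<in> E. x \<in> e'} - {{}} = {e' \<in> E. x \<in> e'}"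
    by auto
  then show ?thesis
    using assms finite_E by (simp add: sum_diff1)
qed

text \<open>Two steps inside \<open>e\<close> return to \<open>x\<close> through each of the
  \<open>u - 1\<close> other vertices. They reach any other \<open>z\<close> through the
  \<open>u - 2\<close> vertices different from \<open>x\<close> and \<open>z\<close>.\<close>

lemma double_sum_edge:
  fixes g :: "'a \<Rightarrow> real"
  assumes "e \<in> E" "x \<in> e"
  shows "(\<Sum>y\<in>e - {x}. \<Sum>z\<in>e - {y}. g z) = (real u - 1) * g x + (real u - 2) * (\<Sum>z\<in>e - {x}. g z)"
proof -
  have fin: "finite e" using assms finite_edge by blast
  have card: "real (card (e - {x})) = real u - 1"
    using assms card_edge two_le_u fin by (simp add: of_nat_diff)
  have "(\<Sum>y\<in>e - {x}. \<Sum>z\<in>e - {y}. g z) = (\<Sum>y\<in>e - {x}. (\<Sum>z\<in>e. g z) - g y)"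
    using fin by (intro sum.cong) (auto simp: sum_diff1)
  also have "\<dots> = (real u - 1) * (\<Sum>z\<in>e. g z) - (\<Sum>y\<in>e - {x}. g y)"
    by (simp add: sum_subtractf card)
  also have "(\<Sum>z\<in>e. g z) = g x + (\<Sum>z\<in>e - {x}. g z)"
    using fin assms by (simp add: sum.remove)
  finally show ?thesis
    by (simp add: algebra_simps)
qed

text \<open>A walk of positive length from \<open>x\<close> is counted once for each edge at
  \<open>x\<close> except its first one. A walk of length 0 has no first edge and is counted
  \<open>r\<close> times, which is why \<open>F_poly\<close> has a different coefficient at index
  2.\<close>

lemma sum_star_nb_sum:
  assumes "x \<in> V"
  shows "(\<Sum>e | e \<in> E \<and> x \<in> e. nb_sum E f i e x)
    = (if i = 0 then real r else real r - 1) * nb_sum E f i {} x"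
proof (cases i)
  case 0
  then show ?thesis using degree[OF assms] by simp
next
  case (Suc j)
  have eq: "{e' \<in> E. x \<in> e'} - {{}} = {e' \<in> E. x \<in> e'}"
    by auto
  have "(\<Sum>e | e \<in> E \<and> x \<in> e. nb_sum E f i e x)
    = (\<Sum>e | e \<in> E \<and> x \<in> e. nb_sum E f i {} x - (\<Sum>y\<in>e - {x}. nb_sum E f j e y))"
    unfolding Suc by (intro sum.cong refl nb_sum_Suc_avoid) auto
  also have "\<dots> = real r * nb_sum E f i {} x - nb_sum E f i {} x"
    using degree[OF assms] by (simp add: sum_subtractf Suc eq)
  finally show ?thesis
    using Suc by (simp add: algebra_simps)
qed

text \<open>A walk is a step along some \<open>e\<close> followed by a walk avoiding
  \<open>e\<close>. Dropping the avoidance gives the adjacency sum; the correction consists of the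
  walks using \<open>e\<close> twice in a row, which \<open>double_sum_edge\<close> splits into
  returns to \<open>x\<close> and moves to a third vertex.\<close>

lemma nb_sum_Suc_Suc:
  assumes "x \<in> V"
  shows "nb_sum E f (Suc (Suc i)) {} x
    = (\<Sum>y\<in>V. real (hg_adj E x y) * nb_sum E f (Suc i) {} y)
      - (real u - 2) * nb_sum E f (Suc i) {} x
      - (if i = 0 then real r else real r - 1) * (real u - 1) * nb_sum E f i {} x"
proof -
  have eq: "{e' \<in> E. x \<in> e'} - {{}} = {e' \<in> E. x \<in> e'}"
    by auto
  have "nb_sum E f (Suc (Suc i)) {} x
      = (\<Sum>e | e \<in> E \<and> x \<in> e. \<Sum>y\<in>e - {x}. nb_sum E f (Suc i) e y)"
    by (simp add: eq)
  also have "\<dots> = (\<Sum>e | e \<in> E \<and> x \<in> e. (\<Sum>y\<in>e - {x}. nb_sum E f (Suc i) {} y)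
      - (\<Sum>y\<in>e - {x}. \<Sum>z\<in>e - {y}. nb_sum E f i e z))"
    unfolding sum_subtractf[symmetric]
    by (intro sum.cong refl nb_sum_Suc_avoid) auto
  also have "\<dots> = (\<Sum>e | e \<in> E \<and> x \<in> e. (\<Sum>y\<in>e - {x}. nb_sum E f (Suc i) {} y)
      - ((real u - 1) * nb_sum E f i e x + (real u - 2) * (\<Sum>z\<in>e - {x}. nb_sum E f i e z)))"
    by (intro sum.cong refl arg_cong2[where f = minus] double_sum_edge) auto
  also have "\<dots> = (\<Sum>e | e \<in> E \<and> x \<in> e. \<Sum>y\<in>e - {x}. nb_sum E f (Suc i) {} y)
      - (real u - 1) * (\<Sum>e | e \<in> E \<and> x \<in> e. nb_sum E f i e x)
      - (real u - 2) * nb_sum E f (Suc i) {} x"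
    by (simp add: sum_subtractf sum.distrib sum_distrib_left eq del: mult_minus_left)
  finally show ?thesis
    unfolding sum_star_nb_sum[OF assms] sum_adj_eq[OF assms] by (simp add: mult.assoc mult.commute)
qed

lemma nb_sum_eigenfunction:
  assumes f: "\<And>x. x \<in> V \<Longrightarrow> (\<Sum>y\<in>V. real (hg_adj E x y) * f y) = lam * f x"
    and "x \<in> V"
  shows "nb_sum E f i {} x = poly (F_poly r u i) lam * f x"
  using \<open>x \<in> V\<close>
proof (induction i arbitrary: x rule: less_induct)
  case (less i)
  have eq: "{e' \<in> E. x \<in> e'} - {{}} = {e' \<in> E. x \<in> e'}"
    by auto
  have adj: "(\<Sum>y\<in>V. real (hg_adj E x y) * nb_sum E f j {} y)
    = poly (F_poly r u j) lam * (lam * f x)" if "j < i" for j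
    unfolding f[OF less.prems, symmetric] sum_distrib_left
    using less.IH[OF that] by (intro sum.cong) (simp_all add: mult.left_commute)
  consider "i = 0" | "i = 1" | "i = 2" | j where "i = Suc (Suc (Suc j))"
    by (metis One_nat_def Suc_1 not0_implies_Suc)
  then show ?case
  proof cases
    case 1
    then show ?thesis by simp
  next
    case 2
    then show ?thesis
      using f[OF less.prems] sum_adj_eq[OF less.prems, of f] by (simp add: eq)
  next
    case 3
    then have i: "i = Suc (Suc 0)" by simp
    show ?thesis
      unfolding i nb_sum_Suc_Suc[OF less.prems, of f 0]
      using adj[of "Suc 0"] less.IH[of "Suc 0", OF _ less.prems] i
      by (simp add: algebra_simps del: nb_sum.simps(2))
  next
    case 4
    show ?thesis
      unfolding 4 nb_sum_Suc_Suc[OF less.prems, of f "Suc j"]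
      using adj[of "Suc (Suc j)"] less.IH[of "Suc (Suc j)", OF _ less.prems]
        less.IH[of "Suc j", OF _ less.prems] 4
      by (simp add: algebra_simps del: nb_sum.simps(2))
  qed
qed

section \<open>Values at the trivial eigenvalue\<close>

lemma poly_F_trivial:
  "poly (F_poly r u (Suc i)) (real r * (real u - 1))
    = real r * (real u - 1) * ((real r - 1) * (real u - 1)) ^ i"
proof (induction i rule: less_induct)
  case (less i)
  consider "i = 0" | "i = 1" | j where "i = Suc (Suc j)"
    by (metis One_nat_def not0_implies_Suc)
  then show ?case
  proof cases
    case 3
    define c q where "c = real r * (real u - 1)" and "q = (real r - 1) * (real u - 1)"
    have "poly (F_poly r u (Suc i)) c
      = (c - (real u - 2)) * poly (F_poly r u (Suc (Suc j))) c - q * poly (F_poly r u (Suc j)) c"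
      by (simp add: 3 q_def left_diff_distrib)
    \<comment> \<open>With this the recurrence has characteristic roots 1 and \<open>q\<close>, and
      the starting values select the pure power of \<open>q\<close>.\<close>
    also have "c - (real u - 2) = q + 1"
      by (simp add: c_def q_def algebra_simps)
    finally show ?thesis
      using less.IH[of j, folded c_def q_def] less.IH[of "Suc j", folded c_def q_def] 3
      unfolding c_def[symmetric] q_def[symmetric]
      by (simp add: algebra_simps del: F_poly.simps)
  qed (simp_all add: algebra_simps)
qed

lemma poly_G_trivial:
  "poly (G_poly r u d) (real r * (real u - 1))
    = 1 + (\<Sum>i<d. real r * (real u - 1) * ((real r - 1) * (real u - 1)) ^ i)"
proof -
  have "poly (G_poly r u d) c = poly (F_poly r u 0) c + (\<Sum>i<d. poly (F_poly r u (Suc i)) c)" for c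
    unfolding G_poly_def poly_sum by (rule sum.atMost_shift)
  from this[of "real r * (real u - 1)"] show ?thesis
    unfolding poly_F_trivial by simp
qed

section \<open>Kernel entries and their lower bound\<close>

text \<open>By linearity in \<open>f\<close>: the indicator of \<open>z\<close> singles out the
  walks ending at \<open>z\<close>, which gives the matrix entry at \<open>x\<close>,
  \<open>z\<close>.\<close>

lemma nb_sum_kernel:
  assumes "x \<in> V"
  shows "nb_sum E f i e x = (\<Sum>z\<in>V. f z * nb_sum E (indicator {z}) i e x)"
  using assms
proof (induction i arbitrary: e x)
  case 0
  then show ?case
    using finite_V by (simp add: indicator_def sum.delta)
next
  case (Suc i)
  have "nb_sum E f (Suc i) e x = (\<Sum>e'\<in>{e' \<in> E. x \<in> e'} - {e}. \<Sum>y\<in>e' - {x}.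
      \<Sum>z\<in>V. f z * nb_sum E (indicator {z}) i e' y)"
    unfolding nb_sum.simps using edge_subset by (intro sum.cong refl Suc.IH) auto
  also have "\<dots> = (\<Sum>e'\<in>{e' \<in> E. x \<in> e'} - {e}. \<Sum>z\<in>V. \<Sum>y\<in>e' - {x}.
      f z * nb_sum E (indicator {z}) i e' y)"
    by (intro sum.cong refl sum.swap)
  also have "\<dots> = (\<Sum>z\<in>V. \<Sum>e'\<in>{e' \<in> E. x \<in> e'} - {e}. \<Sum>y\<in>e' - {x}.
      f z * nb_sum E (indicator {z}) i e' y)"
    by (rule sum.swap)
  finally show ?case
    by (simp add: sum_distrib_left)
qed

text \<open>
  A shortest walk from \<open>x\<close> cannot start with \<open>e\<close> if some vertex \<open>y\<close> of \<open>e\<close> is farther from \<open>z\<close>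
  than \<open>x\<close>, since otherwise \<open>y\<close> could skip \<open>x\<close>.
\<close>

lemma one_le_nb_sum_shortest:
  assumes "hg_joined V E p x z" "\<And>m. m < p \<Longrightarrow> \<not> hg_joined V E m x z"
    and "e = {} \<or> (\<exists>y\<in>e. \<forall>m\<le>p. \<not> hg_joined V E m y z)"
  shows "1 \<le> nb_sum E (indicator {z}) p e x"
  using assms
proof (induction p arbitrary: e x)
  case 0
  then show ?case
    by (simp add: hg_joined_0_iff)
next
  case (Suc p)
  obtain e' x' where e': "e' \<in> E" "x \<in> V" "x \<in> e'" "x' \<in> e'" "x \<noteq> x'" "hg_joined V E p x' z"
    using Suc.prems(1) by (auto simp: hg_joined_Suc_iff)
  have "e' \<noteq> e"
  proof
    assume "e' = e"
    then obtain y where y: "y \<in> e'" "\<And>m. m \<le> Suc p \<Longrightarrow> \<not> hg_joined V E m y z"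
      using Suc.prems(3) e'(3) by auto
    \<comment> \<open>The vertex \<open>x'\<close> is joined to \<open>z\<close> by a walk of length
      \<open>p\<close>, while \<open>y\<close> is not.\<close>
    then have "y \<noteq> x'"
      using e'(6) le_SucI by blast
    moreover have "y \<in> V"
      using y(1) e'(1) edge_subset by blast
    ultimately have "hg_joined V E (Suc p) y z"
      unfolding hg_joined_Suc_iff using y(1) e' by blast
    then show False
      using y(2) by blast
  qed
  have "1 \<le> nb_sum E (indicator {z}) p e' x'"
  proof (rule Suc.IH[OF e'(6)])
    fix m assume "m < p"
    then have "\<not> hg_joined V E (Suc m) x z"
      using Suc.prems(2) by simp
    then show "\<not> hg_joined V E m x' z"
      unfolding hg_joined_Suc_iff using e' by blast
  next
    \<comment> \<open>The witness is \<open>x\<close> itself: by minimality of \<open>Suc p\<close>,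
      no walk of length at most \<open>p\<close> joins it to \<open>z\<close>.\<close>
    show "e' = {} \<or> (\<exists>y\<in>e'. \<forall>m\<le>p. \<not> hg_joined V E m y z)"
      using Suc.prems(2) e'(3) by (metis le_imp_less_Suc)
  qed
  also have "\<dots> \<le> (\<Sum>y\<in>e' - {x}. nb_sum E (indicator {z}) p e' y)"
    using e' finite_edge by (intro member_le_sum nb_sum_nonneg) auto
  also have "\<dots> \<le> nb_sum E (indicator {z}) (Suc p) e x"
    unfolding nb_sum.simps using e' \<open>e' \<noteq> e\<close> finite_E
    by (intro member_le_sum[where f = "\<lambda>e'. \<Sum>y\<in>e' - {x}. nb_sum E (indicator {z}) p e' y"]
        sum_nonneg nb_sum_nonneg) auto
  finally show ?case .
qed

lemma one_le_sum_nb_sum: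
  assumes "hg_connected V E" "x \<in> V" "z \<in> V" "hg_dist V E x z \<le> d"
  shows "1 \<le> (\<Sum>i\<le>d. nb_sum E (indicator {z}) i {} x)"
proof -
  have "1 \<le> nb_sum E (indicator {z}) (hg_dist V E x z) {} x"
    using assms by (intro one_le_nb_sum_shortest hg_joined_dist not_hg_joined_less_dist) auto
  also have "\<dots> \<le> (\<Sum>i\<le>d. nb_sum E (indicator {z}) i {} x)"
    using assms(4)
    by (intro member_le_sum[where f = "\<lambda>i. nb_sum E (indicator {z}) i {} x"] nb_sum_nonneg) auto
  finally show ?thesis .
qed

section \<open>The eigenvalue bound\<close>

lemma poly_G_eigenfunction:
  assumes "\<And>x. x \<in> V \<Longrightarrow> (\<Sum>y\<in>V. real (hg_adj E x y) * f y) = lam * f x"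
    and "x \<in> V"
  shows "poly (G_poly r u d) lam * f x
    = (\<Sum>z\<in>V. f z * (\<Sum>i\<le>d. nb_sum E (indicator {z}) i {} x))"
proof -
  have "poly (G_poly r u d) lam * f x = (\<Sum>i\<le>d. nb_sum E f i {} x)"
    using nb_sum_eigenfunction[OF assms] by (simp add: G_poly_def poly_sum sum_distrib_right)
  also have "\<dots> = (\<Sum>i\<le>d. \<Sum>z\<in>V. f z * nb_sum E (indicator {z}) i {} x)"
    by (rule sum.cong[OF refl nb_sum_kernel[OF assms(2)]])
  also have "\<dots> = (\<Sum>z\<in>V. \<Sum>i\<le>d. f z * nb_sum E (indicator {z}) i {} x)"
    by (rule sum.swap)
  finally show ?thesis
    by (simp add: sum_distrib_left)
qed

text \<open>The eigenvalue equation of the kernel is read at a vertex \<open>x\<close> where the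
  absolute value of \<open>f\<close> attains its maximum \<open>M\<close>; dividing by
  \<open>M\<close> leaves the row sum of the kernel minus the all-ones matrix.\<close>

lemma abs_poly_G_le:
  assumes con: "hg_connected V E"
    and f: "\<And>x. x \<in> V \<Longrightarrow> (\<Sum>y\<in>V. real (hg_adj E x y) * f y) = lam * f x"
    and nz: "\<exists>x\<in>V. f x \<noteq> 0"
    and lam: "lam \<noteq> real r * (real u - 1)"
  shows "\<bar>poly (G_poly r u (hg_diameter V E)) lam\<bar>
    \<le> poly (G_poly r u (hg_diameter V E)) (real r * (real u - 1)) - real (card V)"
proof -
  define G where "G = G_poly r u (hg_diameter V E)"
  define M where "M = Max ((\<lambda>x. \<bar>f x\<bar>) ` V)"
  have M_ge: "\<bar>f z\<bar> \<le> M" if "z \<in> V" for z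
    unfolding M_def using that finite_V by (intro Max_ge) auto
  have "M \<in> (\<lambda>x. \<bar>f x\<bar>) ` V"
    unfolding M_def using nz finite_V by (intro Max_in) auto
  then obtain x where x: "x \<in> V" "\<bar>f x\<bar> = M"
    by auto
  have "M > 0"
    using nz M_ge by (metis abs_le_zero_iff abs_ge_zero not_less order_trans x(2))
  define K where "K = (\<lambda>z. (\<Sum>i\<le>hg_diameter V E. nb_sum E (indicator {z}) i {} x))"
  have K: "1 \<le> K z" if "z \<in> V" for z
    unfolding K_def
    using one_le_sum_nb_sum[OF con x(1) that] hg_dist_le_diameter[OF finite_V x(1) that] by blast
  \<comment> \<open>The constant function 1 is an eigenfunction for the trivial eigenvalue.\<close>
  have row: "(\<Sum>z\<in>V. K z) = poly G (real r * (real u - 1))"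
    using poly_G_eigenfunction[of "\<lambda>_. 1" "real r * (real u - 1)", OF _ x(1)] sum_adj_row
    by (simp add: K_def G_def)
  have "poly G lam * f x = (\<Sum>z\<in>V. f z * K z)"
    unfolding G_def K_def using poly_G_eigenfunction[OF f x(1)] .
  \<comment> \<open>Subtracting 1 from every entry costs nothing because \<open>f\<close> sums to
    zero, and it keeps the entries nonnegative.\<close>
  also have "\<dots> = (\<Sum>z\<in>V. f z * (K z - 1))"
    using eigenfunction_sum_zero[OF f lam] by (simp add: right_diff_distrib sum_subtractf)
  finally have "\<bar>poly G lam\<bar> * M = \<bar>\<Sum>z\<in>V. f z * (K z - 1)\<bar>"
    using x(2) by (metis abs_mult)
  also have "\<dots> \<le> (\<Sum>z\<in>V. \<bar>f z * (K z - 1)\<bar>)"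
    by (rule sum_abs)
  also have "\<dots> \<le> (\<Sum>z\<in>V. M * (K z - 1))"
    using K M_ge by (intro sum_mono) (auto simp: abs_mult intro: mult_right_mono)
  also have "\<dots> = (poly G (real r * (real u - 1)) - real (card V)) * M"
    by (simp add: sum_distrib_left[symmetric] sum_subtractf row)
  finally show ?thesis
    using \<open>M > 0\<close> unfolding G_def by simp
qed

end

theorem theorem6p10:
  fixes V :: "'a set" and E :: "'a set set" and r u d n k q :: nat and lam :: real
  assumes "hypergraph V E"
    and "hg_connected V E"
    and "hg_regular r V E"
    and "hg_uniform u E"
    and "hg_girth V E \<ge> 3"
    and "hg_diameter V E = d"
    and "card V = n"
    and "k = r * (u - 1)"
    and "q = (r - 1) * (u - 1)"
    and "hg_eigenvalue V E lam"
    and "lam \<noteq> real k"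
  shows "\<bar>poly (G_poly r u d) lam\<bar> \<le> 1 + (\<Sum>i<d. real k * real q ^ i) - real n"
proof -
  interpret regular_uniform_hypergraph V E r u
    using assms(1,3,4)
    by unfold_locales (auto simp: hypergraph_def hg_regular_def hg_uniform_def)
  \<comment> \<open>Since \<open>r\<close> and \<open>u\<close> are at least 1, the natural-number
    subtractions in \<open>k\<close> and \<open>q\<close> are exact.\<close>
  have k: "real k = real r * (real u - 1)" and q: "real q = (real r - 1) * (real u - 1)"
    using assms(8,9) two_le_u one_le_r by (simp_all add: of_nat_diff)
  obtain f where f: "\<exists>x\<in>V. f x \<noteq> 0"
    "\<And>x. x \<in> V \<Longrightarrow> (\<Sum>y\<in>V. real (hg_adj E x y) * f y) = lam * f x"
    using hg_eigenfunction[OF assms(10)] by blast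
  have "lam \<noteq> real r * (real u - 1)"
    using assms(11) k by simp
  from abs_poly_G_le[OF assms(2) f(2) f(1) this] show ?thesis
    unfolding poly_G_trivial assms(6,7) k q .
qed

end
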